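(* Let $A\in\mathbb{R}^{m\times n}$ have full row rank, let $b\in\mathbb{R}^m$, and suppose $\{x\in\mathbb{R}^n_+ : Ax=b\}\neq\emptyset$. Let $\mathcal{P}_{A,b}=\{y\in\mathbb{R}^n : A(y\circ y)=b\}$. Let $y\in\mathcal{P}_{A,b}$ have regular representation $(M,N,r)$ and let $h\in\mathcal{T}_{\mathcal{P}_{A,b}}(y)$. Let $[V;W]\in\mathbb{R}^{(m-r)\times(m-r)}$ be a full rank matrix such that the rows of $V$ form a basis of $\mathrm{Range}[NAD_h]$ and $VW^\top=0$. Then the inner and outer second-order tangent sets of $\mathcal{P}_{A,b}$ at $(y,h)$ are $$\mathcal{T}^{i,2}_{\mathcal{P}_{A,b}}(y,h)=\mathcal{T}^{2}_{\mathcal{P}_{A,b}}(y,h)=\left\{w\in\mathbb{R}^n : MA(y\circ w+h\circ h)=0,\ VNA(h\circ w)=0,\ WNA(w\circ w)=0\right\}.$$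
   Context: $\circ$ denotes the entrywise (Hadamard) product and $D_y=\mathrm{Diag}(y)$ the diagonal matrix with diagonal $y$. $[P;Q]$ denotes the matrix obtained by stacking $P$ on top of $Q$. Regular representation: for $y\in\mathcal{P}_{A,b}$, a triple $(M,N,r)$ is a regular representation of $y$ if $r=\mathrm{rank}(AD_y)$, $M\in\mathbb{R}^{r\times m}$ has rows forming a basis of $\mathrm{Range}[AD_y]\subset\mathbb{R}^m$, and $N\in\mathbb{R}^{(m-r)\times m}$ has rows forming a basis of the orthogonal complement of $\mathrm{Range}[AD_y]$ in $\mathbb{R}^m$ (so $[M;N]$ is invertible and $MN^\top=0$; $M$ or $N$ may have no rows). It then holds that $MAD_y$ has full row rank, $NAD_y=0$ and $Nb=0$. For a closed set $S\subset\mathbb{R}^n$, $x\in S$ and $h\in\mathbb{R}^n$: - contingent tangent cone: $\mathcal{T}_S(x)=\{h\in\mathbb{R}^n : \exists\, t_k\downarrow 0,\ \mathrm{dist}(x+t_kh,S)=o(t_k)\}$; - inner second-order tangent set: $\mathcal{T}^{i,2}_S(x,h)=\{w\in\mathbb{R}^n : \mathrm{dist}(x+th+t^2w/2,S)=o(t^2),\ t\ge 0\}$ (as $t\downarrow0$); - outer second-order tangent set: $\mathcal{T}^{2}_S(x,h)=\{w\in\mathbb{R}^n : \exists\, t_k\downarrow 0,\ \mathrm{dist}(x+t_kh+t_k^2w/2,S)=o(t_k^2)\}$. *)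

theory Defs
  imports
    "HOL-Analysis.L2_Norm"
    "HOL-Library.Landau_Symbols"
    "Jordan_Normal_Form.DL_Rank"
begin

definition hadamard :: "real vec \<Rightarrow> real vec \<Rightarrow> real vec"  (infixl \<open>\<circ>\<^sub>v\<close> 75)
  where "x \<circ>\<^sub>v y = vec (dim_vec x) (\<lambda>i. x $ i * y $ i)"

definition Diag :: "real vec \<Rightarrow> real mat"
  where "Diag y = mat_diag (dim_vec y) (\<lambda>i. y $ i)"

definition vec_norm2 :: "real vec \<Rightarrow> real"
  where "vec_norm2 v = L2_set (\<lambda>i. v $ i) {..<dim_vec v}"

text \<open>Meaningful only for \<open>S\<close> nonempty and consisting of vectors of the dimension of \<open>x\<close>.\<close>

definition set_dist :: "real vec \<Rightarrow> real vec set \<Rightarrow> real"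
  where "set_dist x S = (INF s\<in>S. vec_norm2 (x - s))"

text \<open>The ambient space of the tangent sets is \<^term>\<open>carrier_vec (dim_vec x)\<close>, and
  \<open>t\<^sub>k \<down> 0\<close> is read as: all \<open>t\<^sub>k\<close> are positive and they tend to \<open>0\<close>.\<close>

definition tangent_cone :: "real vec set \<Rightarrow> real vec \<Rightarrow> real vec set"
  where "tangent_cone S x = {h \<in> carrier_vec (dim_vec x).
    \<exists>t :: nat \<Rightarrow> real. (\<forall>k. t k > 0) \<and> t \<longlonglongrightarrow> 0 \<and>
      (\<lambda>k. set_dist (x + t k \<cdot>\<^sub>v h) S) \<in> o(\<lambda>k. t k)}"

definition inner_tangent2 :: "real vec set \<Rightarrow> real vec \<Rightarrow> real vec \<Rightarrow> real vec set"
  where "inner_tangent2 S x h = {w \<in> carrier_vec (dim_vec x).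
    (\<lambda>t. set_dist (x + t \<cdot>\<^sub>v h + (t\<^sup>2 / 2) \<cdot>\<^sub>v w) S) \<in> o[at_right 0](\<lambda>t. t\<^sup>2)}"

definition outer_tangent2 :: "real vec set \<Rightarrow> real vec \<Rightarrow> real vec \<Rightarrow> real vec set"
  where "outer_tangent2 S x h = {w \<in> carrier_vec (dim_vec x).
    \<exists>t :: nat \<Rightarrow> real. (\<forall>k. t k > 0) \<and> t \<longlonglongrightarrow> 0 \<and>
      (\<lambda>k. set_dist (x + t k \<cdot>\<^sub>v h + ((t k)\<^sup>2 / 2) \<cdot>\<^sub>v w) S) \<in> o(\<lambda>k. (t k)\<^sup>2)}"

text \<open>\<open>distinct\<close> is needed because \<open>set\<close> would hide repeated rows. A matrix without
  rows is a basis of the zero subspace.\<close>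

definition rows_basis :: "real mat \<Rightarrow> real vec set \<Rightarrow> bool"
  where "rows_basis B U \<longleftrightarrow> distinct (rows B) \<and>
    vectorspace.basis class_ring ((module_vec TYPE(real) (dim_col B))\<lparr>carrier := U\<rparr>) (set (rows B))"

definition Pset :: "real mat \<Rightarrow> real vec \<Rightarrow> real vec set"
  where "Pset A b = {y \<in> carrier_vec (dim_col A). A *\<^sub>v (y \<circ>\<^sub>v y) = b}"

text \<open>The range of a matrix with \<open>k\<close> rows is its column space inside \<^term>\<open>carrier_vec k\<close>.\<close>

definition regular_rep :: "real mat \<Rightarrow> real vec \<Rightarrow> real mat \<Rightarrow> real mat \<Rightarrow> nat \<Rightarrow> bool"
  where "regular_rep A y M N r \<longleftrightarrow>
    r = vec_space.rank (dim_row A) (A * Diag y) \<and>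
    M \<in> carrier_mat r (dim_row A) \<and>
    rows_basis M (vec_space.col_space (dim_row A) (A * Diag y)) \<and>
    N \<in> carrier_mat (dim_row A - r) (dim_row A) \<and>
    rows_basis N (vec_module.orthogonal_complement (dim_row A)
      (vec_space.col_space (dim_row A) (A * Diag y)))"

end

theory Submission
  imports Defs
begin

text \<open>
  Necessity is a Taylor expansion: for points \<open>y + t h + t\<^sup>2 w / 2 + o(t\<^sup>2)\<close> of the set, the
  coefficients of \<open>A (x \<circ> x) = b\<close> at order \<open>t\<^sup>2\<close>, then those of its image under \<open>N\<close> at order
  \<open>t\<^sup>3\<close>, and of its image under \<open>W N\<close> at order \<open>t\<^sup>4\<close>, vanish in the limit.

  Conversely, orthogonality turns the three equations into \<open>A (y \<circ> w + h \<circ> h) = 0\<close>,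
  \<open>A (h \<circ> w) = A (y \<circ> \<alpha>)\<close> and \<open>A (w \<circ> w) = A (h \<circ> \<beta> + y \<circ> \<gamma>)\<close>. With
  \<open>a = y + t h + t\<^sup>2 w / 2\<close>, every \<open>x\<close> with
  \<open>x \<circ> x = a \<circ> a - t\<^sup>3 (y \<circ> \<alpha>) - t\<^sup>4 / 4 (h \<circ> \<beta> + y \<circ> \<gamma>)\<close> lies in the set. Such an \<open>x\<close> exists
  within \<open>O(t\<^sup>3)\<close> of \<open>a\<close>, coordinate by coordinate: where \<open>y \<noteq> 0\<close> the correction \<open>O(t\<^sup>3)\<close>
  is divided by \<open>\<bar>a\<bar> \<approx> \<bar>y\<bar>\<close>, where only \<open>h \<noteq> 0\<close> the correction \<open>O(t\<^sup>4)\<close> is divided by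
  \<open>\<bar>a\<bar> \<approx> t \<bar>h\<bar>\<close>, and elsewhere there is no correction. No implicit function theorem is needed.
\<close>

section \<open>Orthogonal complements and row bases\<close>

text \<open>A basis spans, spanning inside the subspace agrees with spanning in the ambient space,
  and the row space of \<open>B\<close> is the image of its transpose. Membership in
  \<open>U\<close> thus yields a coefficient vector.\<close>

lemma rows_basis_range:
  assumes B: "B \<in> carrier_mat r k" and basis: "rows_basis B U"
    and sub: "submodule class_ring U (module_vec TYPE(real) k)"
  shows "U = (\<lambda>a. B\<^sup>T *\<^sub>v a) ` carrier_vec r"
proof -
  interpret vec_space "TYPE(real)" k .
  have vs: "vectorspace class_ring (vs U)"
    by (rule subspace_is_vs) (simp add: subspace_def sub vec_vs)
  have "vectorspace.basis class_ring (vs U) (set (rows B))"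
    using basis B by (simp add: rows_basis_def)
  then have "module.span class_ring (vs U) (set (rows B)) = U" and "set (rows B) \<subseteq> U"
    unfolding vectorspace.basis_def[OF vs] by simp_all
  then have "span (set (rows B)) = U"
    using span_li_not_depend(1)[OF _ sub] by simp
  then have "U = {w \<in> carrier_vec k. \<exists>a\<in>carrier_vec r. B\<^sup>T *\<^sub>v a = w}"
    using row_space_eq[OF B] B unfolding row_space_def by simp
  then show ?thesis using B by auto
qed

lemma submodule_col_space:
  assumes "B \<in> carrier_mat k n"
  shows "submodule class_ring (vec_space.col_space k (B :: real mat)) (module_vec TYPE(real) k)"
proof -
  interpret vec_space "TYPE(real)" k .
  show ?thesis
    unfolding col_space_def using assms cols_dim[of B] by (intro span_is_submodule) auto
qed

lemma submodule_orthogonal_complement: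
  assumes "U \<subseteq> carrier_vec k"
  shows "submodule class_ring (vec_module.orthogonal_complement k U) (module_vec TYPE(real) k)"
proof -
  interpret vec_space "TYPE(real)" k .
  show ?thesis
    using assms unfolding orthogonal_complement_def
    by unfold_locales (auto simp: module_vec_simps add_scalar_prod_distrib[of _ k] subsetD)
qed

lemma col_space_range:
  assumes "B \<in> carrier_mat k n"
  shows "vec_space.col_space k (B :: real mat) = (\<lambda>x. B *\<^sub>v x) ` carrier_vec n"
  using vec_space.col_space_eq[OF assms] assms by auto

lemma scalar_prod_self_eq_0:
  assumes "(v :: real vec) \<in> carrier_vec k" "v \<bullet> v = 0"
  shows "v = 0\<^sub>v k"
  using conjugate_square_eq_0_vec[OF assms(1)] assms(2) by simp

lemma eq_of_diff_0_vec:
  assumes "(u :: real vec) \<in> carrier_vec k" "v \<in> carrier_vec k" "u - v = 0\<^sub>v k"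
  shows "u = v"
proof (rule eq_vecI)
  fix i assume "i < dim_vec v"
  then show "u $ i = v $ i" using arg_cong[OF assms(3), of "\<lambda>x. x $ i"] assms(1,2) by simp
qed (use assms in auto)

text \<open>The squared norm of \<open>B\<^sup>T *\<^sub>v a\<close> is \<open>a\<close> paired with
  \<open>B *\<^sub>v (B\<^sup>T *\<^sub>v a)\<close>. Hence a matrix is injective on its own row
  space.\<close>

lemma transpose_kernel_trivial:
  fixes B :: "real mat"
  assumes B: "B \<in> carrier_mat r k" and a: "a \<in> carrier_vec r" and 0: "B *\<^sub>v (B\<^sup>T *\<^sub>v a) = 0\<^sub>v r"
  shows "B\<^sup>T *\<^sub>v a = 0\<^sub>v k"
proof -
  have "(B\<^sup>T *\<^sub>v a) \<bullet> (B\<^sup>T *\<^sub>v a) = 0"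
    using transpose_vec_mult_scalar[OF B _ a] 0 B a by simp
  then show ?thesis using scalar_prod_self_eq_0[of _ k] B a by auto
qed

text \<open>Gram-Schmidt, one vector at a time: project \<open>c\<close> and the new vector
  \<open>v\<close> onto the span of the rest, then remove from the residual of \<open>c\<close> its
  component along the residual of \<open>v\<close>.\<close>

lemma orthogonal_projection_span:
  fixes vs :: "real vec list"
  assumes "set vs \<subseteq> carrier_vec k" and "c \<in> carrier_vec k"
  shows "\<exists>u\<in>LinearCombinations.module.span class_ring (module_vec TYPE(real) k) (set vs). \<forall>v\<in>set vs. (c - u) \<bullet> v = 0"
  using assms
proof (induction vs arbitrary: c)
  case Nil
  interpret vec_space "TYPE(real)" k .
  show ?case by (auto simp: span_empty)
next
  case (Cons v vs)
  interpret vec_space "TYPE(real)" k .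
  let ?S = "span (set vs)" and ?T = "span (set (v # vs))"
  have vc: "v \<in> carrier_vec k" and vsc: "set vs \<subseteq> carrier_vec k" using Cons.prems by auto
  have Sc: "?S \<subseteq> carrier_vec k" using span_closed[OF vsc] by auto
  have ST: "?S \<subseteq> ?T" by (rule span_is_monotone) auto
  have perp: "z \<bullet> u = 0" if "z \<in> carrier_vec k" "\<forall>v\<in>set vs. z \<bullet> v = 0" "u \<in> ?S" for z u
    using that in_orthogonal_complement_span[OF vsc] unfolding orthogonal_complement_def by blast
  obtain c1 where c1: "c1 \<in> ?S" "\<forall>x\<in>set vs. (c - c1) \<bullet> x = 0"
    using Cons.IH[OF vsc Cons.prems(2)] by auto
  obtain v1 where v1: "v1 \<in> ?S" "\<forall>x\<in>set vs. (v - v1) \<bullet> x = 0"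
    using Cons.IH[OF vsc vc] by auto
  define c2 v2 where "c2 = c - c1" and "v2 = v - v1"
  \<comment> \<open>If \<open>v\<close> already lies in the old span, then \<open>v2\<close> is zero
    and division by zero gives \<open>t = 0\<close>, which is the right coefficient.\<close>
  define t where "t = (c2 \<bullet> v2) / (v2 \<bullet> v2)"
  define u where "u = c1 + t \<cdot>\<^sub>v v2"
  have car: "c1 \<in> carrier_vec k" "v1 \<in> carrier_vec k" "c2 \<in> carrier_vec k" "v2 \<in> carrier_vec k"
    using c1 v1 Sc vc Cons.prems by (auto simp: c2_def v2_def)
  have T: "submodule class_ring ?T V" using Cons.prems(1) by (intro span_is_submodule) auto
  have vT: "v \<in> ?T" using in_own_span[of "set (v # vs)"] Cons.prems(1) by auto
  have v2_alt: "v2 = v + (-1) \<cdot>\<^sub>v v1" using car vc by (auto simp: v2_def)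
  have "v2 \<in> ?T"
    unfolding v2_alt using submodule.smult_closed[OF T, of "-1" v1] submodule.m_closed[OF T vT] v1(1) ST
    by (auto simp: module_vec_simps)
  then have uT: "u \<in> ?T"
    unfolding u_def using submodule.smult_closed[OF T, of t v2] submodule.m_closed[OF T, of c1] c1(1) ST
    by (auto simp: module_vec_simps)
  have cu: "c - u = c2 - t \<cdot>\<^sub>v v2" using car Cons.prems(2) by (auto simp: u_def c2_def)
  have dot: "(c - u) \<bullet> x = c2 \<bullet> x - t * (v2 \<bullet> x)" if "x \<in> carrier_vec k" for x
    unfolding cu using car that by (simp add: minus_scalar_prod_distrib)
  have "(c - u) \<bullet> x = 0" if "x \<in> set vs" for x
    using that dot[of x] vsc c1(2) v1(2) by (auto simp: c2_def v2_def)
  moreover have "(c - u) \<bullet> v = 0"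
  proof -
    \<comment> \<open>\<open>v1\<close> lies in the old span, to which both residuals are
      orthogonal, so pairing them with \<open>v\<close> is pairing them with
      \<open>v2\<close>.\<close>
    have "c2 \<bullet> v1 = 0" "v2 \<bullet> v1 = 0"
      using perp[OF car(3) _ v1(1)] perp[OF car(4) _ v1(1)] c1(2) v1(2) by (auto simp: c2_def v2_def)
    moreover have v: "v = v1 + v2" using car vc by (auto simp: v2_def)
    ultimately have "c2 \<bullet> v = c2 \<bullet> v2" "v2 \<bullet> v = v2 \<bullet> v2"
      unfolding v using car by (simp_all add: scalar_prod_add_distrib[of _ k])
    moreover have "c2 \<bullet> v2 = 0" if "v2 \<bullet> v2 = 0"
      using scalar_prod_self_eq_0[OF car(4) that] car by simp
    ultimately show ?thesis using dot[OF vc] by (auto simp: t_def)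
  qed
  ultimately show ?case using uT by auto
qed

section \<open>Bases of orthogonal complements and their kernels\<close>

lemma range_complement_basis:
  fixes B N :: "real mat"
  assumes B: "B \<in> carrier_mat k n" and N: "N \<in> carrier_mat q k"
    and basis: "rows_basis N (vec_module.orthogonal_complement k (vec_space.col_space k B))"
  shows "vec_module.orthogonal_complement k (vec_space.col_space k B) = (\<lambda>a. N\<^sup>T *\<^sub>v a) ` carrier_vec q"
proof (rule rows_basis_range[OF N basis submodule_orthogonal_complement])
  show "vec_space.col_space k B \<subseteq> carrier_vec k" using col_space_range[OF B] B by auto
qed

lemma complement_basis_mult_0:
  fixes B N :: "real mat"
  assumes B: "B \<in> carrier_mat k n" and N: "N \<in> carrier_mat q k"
    and basis: "rows_basis N (vec_module.orthogonal_complement k (vec_space.col_space k B))"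
    and u: "u \<in> vec_space.col_space k B"
  shows "N *\<^sub>v u = 0\<^sub>v q"
proof (rule eq_vecI)
  interpret vec_space "TYPE(real)" k .
  fix i assume i: "i < dim_vec (0\<^sub>v q :: real vec)"
  \<comment> \<open>Writing a row as the image of a unit vector under the transpose exhibits it as
    an element of the complement.\<close>
  have "row N i = N\<^sup>T *\<^sub>v unit_vec q i" using N i by auto
  then have "row N i \<in> orthogonal_complement (col_space B)"
    unfolding range_complement_basis[OF B N basis] by auto
  then show "(N *\<^sub>v u) $ i = 0\<^sub>v q $ i"
    using u N i by (auto simp: orthogonal_complement_def)
qed (use N in auto)

text \<open>Subtract from \<open>c\<close> its projection \<open>u\<close> onto the column space.
  The residual is orthogonal to that space, hence in the row space of \<open>N\<close>, and
  \<open>N\<close> kills it; by injectivity on the row space it vanishes.\<close>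

lemma kernel_of_complement_basis:
  fixes B N :: "real mat"
  assumes B: "B \<in> carrier_mat k n" and N: "N \<in> carrier_mat q k"
    and basis: "rows_basis N (vec_module.orthogonal_complement k (vec_space.col_space k B))"
    and c: "c \<in> carrier_vec k" and Nc: "N *\<^sub>v c = 0\<^sub>v q"
  obtains x where "x \<in> carrier_vec n" "c = B *\<^sub>v x"
proof -
  interpret vec_space "TYPE(real)" k .
  have cols: "set (cols B) \<subseteq> carrier_vec k" using B cols_dim[of B] by auto
  obtain u where u: "u \<in> col_space B" and perp: "\<forall>v\<in>set (cols B). (c - u) \<bullet> v = 0"
    using orthogonal_projection_span[OF cols c] unfolding col_space_def by auto
  have uc: "u \<in> carrier_vec k" using u span_closed[OF cols] unfolding col_space_def by auto
  have "c - u \<in> orthogonal_complement (col_space B)"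
    unfolding col_space_def in_orthogonal_complement_span[OF cols]
    using perp c uc by (auto simp: orthogonal_complement_def)
  then obtain a where a: "a \<in> carrier_vec q" "c - u = N\<^sup>T *\<^sub>v a"
    unfolding range_complement_basis[OF B N basis] by auto
  have Nu: "N *\<^sub>v u = 0\<^sub>v q" using complement_basis_mult_0[OF B N basis u] .
  have "N *\<^sub>v (c - u) = 0\<^sub>v q" using mult_minus_distrib_mat_vec[OF N c uc] Nc Nu by simp
  then have "c - u = 0\<^sub>v k" using transpose_kernel_trivial[OF N a(1)] a(2) by simp
  then have "c = u" using eq_of_diff_0_vec[OF c uc] by simp
  then show ?thesis using u that unfolding col_space_range[OF B] by auto
qed

section \<open>Stacked blocks with mutually orthogonal rows\<close>

lemma orthogonal_block_mult_0:
  fixes V W :: "real mat"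
  assumes V: "V \<in> carrier_mat s k" and W: "W \<in> carrier_mat p k" and orth: "V * W\<^sup>T = 0\<^sub>m s p"
    and a: "a \<in> carrier_vec s"
  shows "W *\<^sub>v (V\<^sup>T *\<^sub>v a) = 0\<^sub>v p"
proof -
  have "W * V\<^sup>T = (V * W\<^sup>T)\<^sup>T" using transpose_mult[OF V, of "W\<^sup>T" p] W by simp
  also have "\<dots> = 0\<^sub>m p s" by (simp add: orth)
  finally have "(W * V\<^sup>T) *\<^sub>v a = 0\<^sub>v p" using a by (auto intro!: eq_vecI)
  then show ?thesis using W V a by (simp add: assoc_mult_mat_vec[of W p k _ s])
qed

text \<open>Project \<open>c\<close> onto the row space of \<open>V\<close>. The residual is killed
  by \<open>V\<close>, being orthogonal to its rows, and by \<open>W\<close>, which kills both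
  \<open>c\<close> and that row space. The stacked matrix is square of full rank, so the residual is
  zero.\<close>

lemma kernel_of_orthogonal_block:
  fixes V W :: "real mat"
  assumes V: "V \<in> carrier_mat s k" and W: "W \<in> carrier_mat p k" and sp: "s + p = k"
    and full: "vec_space.rank k (V @\<^sub>r W) = k" and orth: "V * W\<^sup>T = 0\<^sub>m s p"
    and c: "c \<in> carrier_vec k" and Wc: "W *\<^sub>v c = 0\<^sub>v p"
  obtains a where "a \<in> carrier_vec s" "c = V\<^sup>T *\<^sub>v a"
proof -
  interpret vec_space "TYPE(real)" k .
  let ?Q = "V @\<^sub>r W"
  have Q: "?Q \<in> carrier_mat k k" using V W sp by auto
  have rows: "set (rows V) \<subseteq> carrier_vec k" using V rows_carrier[of V] by auto
  obtain u where u: "u \<in> row_space V" and perp: "\<forall>v\<in>set (rows V). (c - u) \<bullet> v = 0"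
    using orthogonal_projection_span[OF rows c] unfolding row_space_def by auto
  obtain a where a: "a \<in> carrier_vec s" and ua: "u = V\<^sup>T *\<^sub>v a"
    using u V unfolding row_space_eq[OF V] by auto
  have uc: "u \<in> carrier_vec k" using ua a V by auto
  have "W *\<^sub>v u = 0\<^sub>v p" unfolding ua using orthogonal_block_mult_0[OF V W orth a] .
  then have "W *\<^sub>v (c - u) = 0\<^sub>v p" using mult_minus_distrib_mat_vec[OF W c uc] Wc by simp
  moreover have "V *\<^sub>v (c - u) = 0\<^sub>v s"
  proof (rule eq_vecI)
    fix i assume i: "i < dim_vec (0\<^sub>v s :: real vec)"
    then have "row V i \<in> set (rows V)" using V by (auto simp: rows_def)
    then have "(c - u) \<bullet> row V i = 0" using perp by blast
    then show "(V *\<^sub>v (c - u)) $ i = 0\<^sub>v s $ i"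
      using V i c uc by (simp add: comm_scalar_prod[of "row V i" k])
  qed (use V in auto)
  moreover have "0\<^sub>v s @\<^sub>v 0\<^sub>v p = (0\<^sub>v k :: real vec)" using sp by auto
  ultimately have "?Q *\<^sub>v (c - u) = 0\<^sub>v k" using mat_mult_append[OF V W, of "c - u"] c uc by simp
  moreover have "det ?Q \<noteq> 0" using det_rank_iff[OF Q] full by simp
  ultimately have "c - u = 0\<^sub>v k" using det_0_iff_vec_prod_zero_field[OF Q] minus_carrier_vec[OF c uc] by blast
  then have "c = u" using eq_of_diff_0_vec[OF c uc] by simp
  then show ?thesis using that a ua by blast
qed

section \<open>Hadamard products and distances\<close>

lemma hadamard_carrier [simp]: "x \<in> carrier_vec n \<Longrightarrow> x \<circ>\<^sub>v y \<in> carrier_vec n"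
  unfolding hadamard_def by (rule carrier_vecI) simp

lemma hadamard_dim [simp]: "dim_vec (x \<circ>\<^sub>v y) = dim_vec x"
  by (simp add: hadamard_def)

lemma hadamard_index [simp]: "i < dim_vec x \<Longrightarrow> (x \<circ>\<^sub>v y) $ i = x $ i * y $ i"
  by (simp add: hadamard_def)

lemma Diag_mult_vec:
  assumes "x \<in> carrier_vec n" "y \<in> carrier_vec n"
  shows "Diag y *\<^sub>v x = y \<circ>\<^sub>v x"
proof (rule eq_vecI)
  fix i assume i: "i < dim_vec (y \<circ>\<^sub>v x)"
  have "(Diag y *\<^sub>v x) $ i = (\<Sum>j\<in>{0..<n}. (if i = j then y $ j else 0) * x $ j)"
    using i assms by (simp add: Diag_def mat_diag_def scalar_prod_def)
  also have "\<dots> = (\<Sum>j\<in>{0..<n}. if i = j then y $ j * x $ j else 0)"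
    by (rule sum.cong) auto
  also have "\<dots> = y $ i * x $ i" using i assms by simp
  finally show "(Diag y *\<^sub>v x) $ i = (y \<circ>\<^sub>v x) $ i" using i assms by simp
qed (use assms in \<open>simp add: Diag_def mat_diag_def\<close>)

lemma Diag_carrier [simp]: "y \<in> carrier_vec n \<Longrightarrow> Diag y \<in> carrier_mat n n"
  unfolding Diag_def by (simp add: carrier_vecD)

lemma mult_Diag_vec:
  assumes "B \<in> carrier_mat k n" "x \<in> carrier_vec n" "y \<in> carrier_vec n"
  shows "(B * Diag y) *\<^sub>v x = B *\<^sub>v (y \<circ>\<^sub>v x)"
  using assoc_mult_mat_vec[OF assms(1) Diag_carrier[OF assms(3)] assms(2)] Diag_mult_vec[OF assms(2,3)]
  by simp

lemma col_space_mult_Diag: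
  assumes "B \<in> carrier_mat k n" "y \<in> carrier_vec n"
  shows "vec_space.col_space k (B * Diag y) = (\<lambda>x. B *\<^sub>v (y \<circ>\<^sub>v x)) ` carrier_vec n"
  unfolding col_space_range[OF mult_carrier_mat[OF assms(1) Diag_carrier[OF assms(2)]]]
  by (rule image_cong[OF refl mult_Diag_vec[OF assms(1) _ assms(2)]])

section \<open>Euclidean norm, distance to a set and limits\<close>

lemma abs_index_le_vec_norm2:
  assumes "i < dim_vec v"
  shows "\<bar>v $ i\<bar> \<le> vec_norm2 v"
  unfolding vec_norm2_def using member_le_L2_set[of "{..<dim_vec v}" i "\<lambda>i. \<bar>v $ i\<bar>"] assms
  by (simp add: L2_set_def)

lemma vec_norm2_nonneg [simp]: "0 \<le> vec_norm2 v"
  by (simp add: vec_norm2_def)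

lemma vec_norm2_le_dim_mult:
  assumes "v \<in> carrier_vec n" "\<And>i. i < n \<Longrightarrow> \<bar>v $ i\<bar> \<le> c"
  shows "vec_norm2 v \<le> real n * c"
proof -
  have "vec_norm2 v \<le> (\<Sum>i<n. \<bar>v $ i\<bar>)"
    unfolding vec_norm2_def using L2_set_le_sum_abs assms(1) by auto
  also have "\<dots> \<le> real n * c" using sum_bounded_above[of "{..<n}" "\<lambda>i. \<bar>v $ i\<bar>" c] assms(2) by simp
  finally show ?thesis .
qed

lemma set_dist_nonneg: "S \<noteq> {} \<Longrightarrow> 0 \<le> set_dist x S"
  unfolding set_dist_def by (rule cINF_greatest) auto

lemma set_dist_le:
  assumes "s \<in> S"
  shows "set_dist x S \<le> vec_norm2 (x - s)"
  unfolding set_dist_def by (rule cINF_lower[OF _ assms]) (auto intro: bdd_belowI[of _ 0])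

lemma set_dist_less_witness:
  assumes "S \<noteq> {}" "set_dist x S < e"
  obtains s where "s \<in> S" "vec_norm2 (x - s) < e"
proof -
  have "bdd_below ((\<lambda>s. vec_norm2 (x - s)) ` S)" by (rule bdd_belowI[of _ 0]) auto
  then show ?thesis
    using cINF_less_iff[OF assms(1), of "\<lambda>s. vec_norm2 (x - s)" e] assms(2) that
    by (auto simp: set_dist_def)
qed

text \<open>Replaces a distance estimate by points of \<open>S\<close> with error vectors tending to
  zero, so that the equation defining the set can be expanded at these points.\<close>

lemma small_set_dist_approximants:
  assumes S: "S \<noteq> {}" "S \<subseteq> carrier_vec n" and x: "\<And>k :: nat. x k \<in> carrier_vec n"
    and c: "\<And>k. c k > 0" and small: "(\<lambda>k. set_dist (x k) S) \<in> o(c)"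
  obtains e where "\<And>k. e k \<in> carrier_vec n" "\<And>k. x k + c k \<cdot>\<^sub>v e k \<in> S"
    "\<And>i. i < n \<Longrightarrow> (\<lambda>k. e k $ i) \<longlonglongrightarrow> 0"
proof -
  \<comment> \<open>The infimum is not assumed to be attained; the positive slack
    \<open>c k / (k + 1)\<close> admits a near-minimizer and is itself of order
    \<open>o(c)\<close>.\<close>
  have "\<exists>s\<in>S. vec_norm2 (x k - s) < set_dist (x k) S + c k * inverse (Suc k)" for k
  proof -
    have "set_dist (x k) S < set_dist (x k) S + c k * inverse (Suc k)" using c[of k] by simp
    then show ?thesis using set_dist_less_witness[OF S(1)] by blast
  qed
  then obtain s where s: "\<And>k. s k \<in> S" "\<And>k. vec_norm2 (x k - s k) < set_dist (x k) S + c k * inverse (Suc k)"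
    by metis
  have sc: "s k \<in> carrier_vec n" for k using s(1) S(2) by auto
  define e where "e k = vec n (\<lambda>i. (s k $ i - x k $ i) / c k)" for k
  have "e k \<in> carrier_vec n" for k by (simp add: e_def)
  moreover have "x k + c k \<cdot>\<^sub>v e k = s k" for k
    using sc[of k] x[of k] c[of k] by (auto intro!: eq_vecI simp: e_def)
  moreover have "(\<lambda>k. e k $ i) \<longlonglongrightarrow> 0" if i: "i < n" for i
  proof (rule tendsto_0_le[where K = 1])
    have "(\<lambda>k. set_dist (x k) S / c k) \<longlonglongrightarrow> 0" using small by (rule smalloD_tendsto)
    then show "(\<lambda>k. set_dist (x k) S / c k + inverse (Suc k)) \<longlonglongrightarrow> 0"
      using LIMSEQ_inverse_real_of_nat tendsto_add_zero by blast
    show "\<forall>\<^sub>F k in sequentially. norm (e k $ i) \<le> norm (set_dist (x k) S / c k + inverse (Suc k)) * 1"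
    proof (intro always_eventually allI)
      fix k
      have "\<bar>s k $ i - x k $ i\<bar> \<le> vec_norm2 (x k - s k)"
        using abs_index_le_vec_norm2[of i "x k - s k"] i sc[of k] x[of k] by (simp add: abs_minus_commute)
      also have "\<dots> \<le> set_dist (x k) S + c k * inverse (Suc k)" using s(2)[of k] by simp
      finally have "\<bar>e k $ i\<bar> \<le> (set_dist (x k) S + c k * inverse (Suc k)) / c k"
        using i c[of k] by (simp add: e_def divide_right_mono)
      also have "\<dots> = set_dist (x k) S / c k + inverse (Suc k)"
        using c[of k] by (simp add: add_divide_distrib)
      finally show "norm (e k $ i) \<le> norm (set_dist (x k) S / c k + inverse (Suc k)) * 1" by simp
    qed
  qed
  ultimately show ?thesis using s(1) by (intro that[of e]) simp_all
qed

text \<open>Kernels are closed: each entry of the product is a finite sum of continuous terms, so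
  coordinatewise convergence suffices.\<close>

lemma mult_mat_vec_limit_0:
  fixes Q :: "real mat"
  assumes Q: "Q \<in> carrier_mat q n" and l: "l \<in> carrier_vec n"
    and g: "\<And>k :: nat. g k \<in> carrier_vec n" "\<And>k. Q *\<^sub>v g k = 0\<^sub>v q"
    and lim: "\<And>i. i < n \<Longrightarrow> (\<lambda>k. g k $ i) \<longlonglongrightarrow> l $ i"
  shows "Q *\<^sub>v l = 0\<^sub>v q"
proof (rule eq_vecI)
  fix i assume "i < dim_vec (0\<^sub>v q :: real vec)"
  then have i: "i < q" by simp
  have entry: "(Q *\<^sub>v v) $ i = (\<Sum>j = 0..<n. Q $$ (i, j) * v $ j)" if "v \<in> carrier_vec n" for v
    using Q that i by (auto simp: scalar_prod_def intro!: sum.cong)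
  have "(\<lambda>k. \<Sum>j = 0..<n. Q $$ (i, j) * g k $ j) \<longlonglongrightarrow> (\<Sum>j = 0..<n. Q $$ (i, j) * l $ j)"
    by (intro tendsto_intros lim) auto
  then have "(\<lambda>k. (Q *\<^sub>v g k) $ i) \<longlonglongrightarrow> (Q *\<^sub>v l) $ i"
    by (simp only: entry[OF g(1)] entry[OF l])
  then show "(Q *\<^sub>v l) $ i = 0\<^sub>v q $ i" using g(2) i by (simp add: LIMSEQ_const_iff)
qed (use Q in auto)

section \<open>Cancellation in matrix kernels\<close>

lemma smult_0_vec [simp]: "(c :: real) \<cdot>\<^sub>v 0\<^sub>v q = 0\<^sub>v q"
  by (rule eq_vecI) auto

lemma mult_mat_0_vec: "(Q :: real mat) \<in> carrier_mat q n \<Longrightarrow> Q *\<^sub>v 0\<^sub>v n = 0\<^sub>v q"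
  by (rule eq_vecI) auto

text \<open>Descends one order in an expansion: the lower-order part \<open>u\<close> drops out and
  the scalar is divided away. With \<open>u\<close> zero it is plain division by
  \<open>c\<close>.\<close>

lemma kernel_cancel:
  fixes Q :: "real mat"
  assumes "Q \<in> carrier_mat q n" "u \<in> carrier_vec n" "v \<in> carrier_vec n"
    and "Q *\<^sub>v u = 0\<^sub>v q" "Q *\<^sub>v (u + c \<cdot>\<^sub>v v) = 0\<^sub>v q" "c \<noteq> 0"
  shows "Q *\<^sub>v v = 0\<^sub>v q"
proof -
  have *: "c \<cdot>\<^sub>v (Q *\<^sub>v v) = 0\<^sub>v q"
    using assms by (simp add: mult_add_distrib_mat_vec[of Q q n] mult_mat_vec[of Q q n])
  show ?thesis
  proof (rule eq_vecI)
    fix i assume "i < dim_vec (0\<^sub>v q :: real vec)"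
    then show "(Q *\<^sub>v v) $ i = 0\<^sub>v q $ i"
      using arg_cong[OF *, of "\<lambda>x. x $ i"] assms(1,6) by simp
  qed (use assms(1) in auto)
qed

lemma diff_kernel:
  fixes Q :: "real mat"
  assumes "Q \<in> carrier_mat q n" "u \<in> carrier_vec n" "v \<in> carrier_vec n"
    and "Q *\<^sub>v (u + v) = Q *\<^sub>v u"
  shows "Q *\<^sub>v v = 0\<^sub>v q"
proof -
  have *: "Q *\<^sub>v u + Q *\<^sub>v v = Q *\<^sub>v u" using assms mult_add_distrib_mat_vec[OF assms(1-3)] by simp
  show ?thesis
  proof (rule eq_vecI)
    fix i assume "i < dim_vec (0\<^sub>v q :: real vec)"
    then have i: "i < q" by simp
    show "(Q *\<^sub>v v) $ i = 0\<^sub>v q $ i" using arg_cong[OF *, of "\<lambda>x. x $ i"] i assms(1) by simp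
  qed (use assms(1) in auto)
qed

section \<open>Necessary equations for tangents\<close>

text \<open>Points \<open>y + t z\<close> with \<open>z\<close> tending to \<open>h\<close> satisfy
  the same equation as \<open>y\<close>. Dividing the difference of the squares by \<open>t\<close>
  gives the first-order equation in the limit; if the first-order term is always killed, a further
  factor \<open>t\<close> cancels. A general \<open>Q\<close> serves both \<open>A\<close> and
  \<open>N * A\<close>.\<close>

lemma tangent_cone_equations:
  fixes Q :: "real mat"
  assumes Q: "Q \<in> carrier_mat q n" and S: "S \<subseteq> Pset Q d" and y: "y \<in> S"
    and h: "h \<in> tangent_cone S y"
  shows "h \<in> carrier_vec n" and "Q *\<^sub>v (y \<circ>\<^sub>v h) = 0\<^sub>v q"
    and "(\<And>x. x \<in> carrier_vec n \<Longrightarrow> Q *\<^sub>v (y \<circ>\<^sub>v x) = 0\<^sub>v q) \<Longrightarrow> Q *\<^sub>v (h \<circ>\<^sub>v h) = 0\<^sub>v q"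
proof -
  have Sc: "S \<subseteq> carrier_vec n" and Sd: "\<And>s. s \<in> S \<Longrightarrow> Q *\<^sub>v (s \<circ>\<^sub>v s) = d" using S Q by (auto simp: Pset_def)
  have yc: "y \<in> carrier_vec n" using y Sc by auto
  then show hc: "h \<in> carrier_vec n" using h by (auto simp: tangent_cone_def)
  obtain t :: "nat \<Rightarrow> real" where t: "\<And>k. t k > 0" "t \<longlonglongrightarrow> 0"
    and small: "(\<lambda>k. set_dist (y + t k \<cdot>\<^sub>v h) S) \<in> o(\<lambda>k. t k)"
    using h by (auto simp: tangent_cone_def)
  obtain e where e: "\<And>k. e k \<in> carrier_vec n" "\<And>k. y + t k \<cdot>\<^sub>v h + t k \<cdot>\<^sub>v e k \<in> S"
    "\<And>i. i < n \<Longrightarrow> (\<lambda>k. e k $ i) \<longlonglongrightarrow> 0"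
    using small_set_dist_approximants[of S n "\<lambda>k. y + t k \<cdot>\<^sub>v h", OF _ Sc _ t(1) small] y yc hc by auto
  define z where "z k = h + e k" for k
  \<comment> \<open>The square of \<open>y + t z\<close> is
    \<open>y \<circ> y + t g\<close>.\<close>
  define g where "g k = 2 \<cdot>\<^sub>v (y \<circ>\<^sub>v z k) + t k \<cdot>\<^sub>v (z k \<circ>\<^sub>v z k)" for k
  have z: "z k \<in> carrier_vec n" for k using hc e(1) by (simp add: z_def)
  have zlim: "(\<lambda>k. z k $ i) \<longlonglongrightarrow> h $ i" if "i < n" for i
    using tendsto_add[OF tendsto_const e(3)[OF that], of "h $ i"] that hc e(1)
    by (simp add: z_def carrier_vecD[OF e(1)])
  have gc: "g k \<in> carrier_vec n" for k using z yc by (simp add: g_def)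
  have g0: "Q *\<^sub>v g k = 0\<^sub>v q" for k
  proof -
    let ?s = "y + t k \<cdot>\<^sub>v h + t k \<cdot>\<^sub>v e k"
    have "?s \<circ>\<^sub>v ?s = y \<circ>\<^sub>v y + t k \<cdot>\<^sub>v g k"
      using yc hc e(1)[of k] by (auto intro!: eq_vecI simp: g_def z_def algebra_simps)
    then have "Q *\<^sub>v (y \<circ>\<^sub>v y + t k \<cdot>\<^sub>v g k) = Q *\<^sub>v (y \<circ>\<^sub>v y)" using Sd[OF e(2)[of k]] Sd[OF y] by simp
    then have "Q *\<^sub>v (t k \<cdot>\<^sub>v g k) = 0\<^sub>v q" using diff_kernel[OF Q, of "y \<circ>\<^sub>v y" "t k \<cdot>\<^sub>v g k"] yc gc by simp
    then show ?thesis using kernel_cancel[OF Q, of "0\<^sub>v n" "g k" "t k"] mult_mat_0_vec[OF Q] t(1)[of k] gc Q by simp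
  qed
  have "Q *\<^sub>v (2 \<cdot>\<^sub>v (y \<circ>\<^sub>v h)) = 0\<^sub>v q"
  proof (rule mult_mat_vec_limit_0[OF Q _ gc g0])
    fix i assume i: "i < n"
    have "(\<lambda>k. 2 * (y $ i * z k $ i) + t k * (z k $ i * z k $ i)) \<longlonglongrightarrow> 2 * (y $ i * h $ i) + 0 * (h $ i * h $ i)"
      by (intro tendsto_intros zlim i t)
    then show "(\<lambda>k. g k $ i) \<longlonglongrightarrow> (2 \<cdot>\<^sub>v (y \<circ>\<^sub>v h)) $ i"
      using i yc hc by (simp add: g_def carrier_vecD[OF z])
  qed (use yc hc in simp)
  then show "Q *\<^sub>v (y \<circ>\<^sub>v h) = 0\<^sub>v q"
    using kernel_cancel[OF Q, of "0\<^sub>v n" "y \<circ>\<^sub>v h" 2] mult_mat_0_vec[OF Q] yc Q by simp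
  assume Qy: "\<And>x. x \<in> carrier_vec n \<Longrightarrow> Q *\<^sub>v (y \<circ>\<^sub>v x) = 0\<^sub>v q"
  show "Q *\<^sub>v (h \<circ>\<^sub>v h) = 0\<^sub>v q"
  proof (rule mult_mat_vec_limit_0[OF Q])
    \<comment> \<open>The first summand of \<open>g\<close> is in the kernel, so the factor
      \<open>t\<close> of the second cancels before the limit is taken.\<close>
    show "Q *\<^sub>v (z k \<circ>\<^sub>v z k) = 0\<^sub>v q" for k
      using kernel_cancel[OF Q _ _ _ g0[of k, unfolded g_def]] t(1)[of k] Qy[OF z] yc z Q
      by (simp add: mult_mat_vec)
    fix i assume i: "i < n"
    have "(\<lambda>k. z k $ i * z k $ i) \<longlonglongrightarrow> h $ i * h $ i" by (intro tendsto_intros zlim i)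
    then show "(\<lambda>k. (z k \<circ>\<^sub>v z k) $ i) \<longlonglongrightarrow> (h \<circ>\<^sub>v h) $ i"
      using i hc by (simp add: carrier_vecD[OF z])
  qed (use hc z in auto)
qed

text \<open>The equations are the coefficients at orders two, three and four. For the last two, the
  lower orders must be killed along the whole sequence and not only in the limit, so that powers of
  \<open>t\<close> can be cancelled. They are applied with \<open>Q\<close> equal to
  \<open>A\<close>, \<open>N * A\<close> and \<open>W * N * A\<close> in turn.\<close>

lemma outer_tangent2_equations:
  fixes Q :: "real mat"
  assumes Q: "Q \<in> carrier_mat q n" and S: "S \<subseteq> Pset Q d" and y: "y \<in> S"
    and hc: "h \<in> carrier_vec n" and Qyh: "Q *\<^sub>v (y \<circ>\<^sub>v h) = 0\<^sub>v q"
    and w: "w \<in> outer_tangent2 S y h"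
  shows "w \<in> carrier_vec n" and "Q *\<^sub>v (y \<circ>\<^sub>v w + h \<circ>\<^sub>v h) = 0\<^sub>v q"
    and "\<lbrakk>\<And>x. x \<in> carrier_vec n \<Longrightarrow> Q *\<^sub>v (y \<circ>\<^sub>v x) = 0\<^sub>v q; Q *\<^sub>v (h \<circ>\<^sub>v h) = 0\<^sub>v q\<rbrakk>
      \<Longrightarrow> Q *\<^sub>v (h \<circ>\<^sub>v w) = 0\<^sub>v q"
    and "\<lbrakk>\<And>x. x \<in> carrier_vec n \<Longrightarrow> Q *\<^sub>v (y \<circ>\<^sub>v x) = 0\<^sub>v q;
          \<And>x. x \<in> carrier_vec n \<Longrightarrow> Q *\<^sub>v (h \<circ>\<^sub>v x) = 0\<^sub>v q\<rbrakk>
      \<Longrightarrow> Q *\<^sub>v (w \<circ>\<^sub>v w) = 0\<^sub>v q"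
proof -
  have Sc: "S \<subseteq> carrier_vec n" and Sd: "\<And>s. s \<in> S \<Longrightarrow> Q *\<^sub>v (s \<circ>\<^sub>v s) = d" using S Q by (auto simp: Pset_def)
  have yc: "y \<in> carrier_vec n" using y Sc by auto
  then show wc: "w \<in> carrier_vec n" using w by (auto simp: outer_tangent2_def)
  obtain t :: "nat \<Rightarrow> real" where t: "\<And>k. t k > 0" "t \<longlonglongrightarrow> 0"
    and small: "(\<lambda>k. set_dist (y + t k \<cdot>\<^sub>v h + ((t k)\<^sup>2 / 2) \<cdot>\<^sub>v w) S) \<in> o(\<lambda>k. (t k)\<^sup>2)"
    using w by (auto simp: outer_tangent2_def)
  have t2: "(t k)\<^sup>2 > 0" for k using t(1)[of k] by simp
  obtain e where e: "\<And>k. e k \<in> carrier_vec n"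
    "\<And>k. y + t k \<cdot>\<^sub>v h + ((t k)\<^sup>2 / 2) \<cdot>\<^sub>v w + (t k)\<^sup>2 \<cdot>\<^sub>v e k \<in> S"
    "\<And>i. i < n \<Longrightarrow> (\<lambda>k. e k $ i) \<longlonglongrightarrow> 0"
    using small_set_dist_approximants[of S n "\<lambda>k. y + t k \<cdot>\<^sub>v h + ((t k)\<^sup>2 / 2) \<cdot>\<^sub>v w", OF _ Sc _ t2 small]
      y yc hc wc by auto
  \<comment> \<open>The approximating point is \<open>y + t h + t\<^sup>2 z / 2\<close>; its square is
    \<open>y \<circ> y + 2 t (y \<circ> h) + t\<^sup>2 g\<close>.\<close>
  define z where "z k = w + 2 \<cdot>\<^sub>v e k" for k
  define f where "f k = h \<circ>\<^sub>v z k + (t k / 4) \<cdot>\<^sub>v (z k \<circ>\<^sub>v z k)" for k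
  define g where "g k = y \<circ>\<^sub>v z k + h \<circ>\<^sub>v h + t k \<cdot>\<^sub>v f k" for k
  have z: "z k \<in> carrier_vec n" for k using wc e(1) by (simp add: z_def)
  have zlim: "(\<lambda>k. z k $ i) \<longlonglongrightarrow> w $ i" if "i < n" for i
    using tendsto_add[OF tendsto_const tendsto_mult_right_zero[OF e(3)[OF that]], of "w $ i" 2] that wc
    by (simp add: z_def carrier_vecD[OF e(1)])
  have fc: "f k \<in> carrier_vec n" for k using z hc by (simp add: f_def)
  have gc: "g k \<in> carrier_vec n" for k using z fc yc hc by (simp add: g_def)
  have flim: "(\<lambda>k. f k $ i) \<longlonglongrightarrow> (h \<circ>\<^sub>v w) $ i" if i: "i < n" for i
  proof -
    have "(\<lambda>k. h $ i * z k $ i + (t k / 4) * (z k $ i * z k $ i)) \<longlonglongrightarrow> h $ i * w $ i + (0 / 4) * (w $ i * w $ i)"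
      by (intro tendsto_intros zlim i t) auto
    then show ?thesis using i hc by (simp add: f_def carrier_vecD[OF z])
  qed
  have g0: "Q *\<^sub>v g k = 0\<^sub>v q" for k
  proof -
    let ?s = "y + t k \<cdot>\<^sub>v h + ((t k)\<^sup>2 / 2) \<cdot>\<^sub>v w + (t k)\<^sup>2 \<cdot>\<^sub>v e k"
    let ?u = "(2 * t k) \<cdot>\<^sub>v (y \<circ>\<^sub>v h)"
    have "?s \<circ>\<^sub>v ?s = y \<circ>\<^sub>v y + (?u + (t k)\<^sup>2 \<cdot>\<^sub>v g k)"
      using yc hc wc e(1)[of k]
      by (auto intro!: eq_vecI simp: g_def f_def z_def field_simps power2_eq_square)
    then have "Q *\<^sub>v (y \<circ>\<^sub>v y + (?u + (t k)\<^sup>2 \<cdot>\<^sub>v g k)) = Q *\<^sub>v (y \<circ>\<^sub>v y)"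
      using Sd[OF e(2)[of k]] Sd[OF y] by simp
    then have "Q *\<^sub>v (?u + (t k)\<^sup>2 \<cdot>\<^sub>v g k) = 0\<^sub>v q"
      using diff_kernel[OF Q, of "y \<circ>\<^sub>v y" "?u + (t k)\<^sup>2 \<cdot>\<^sub>v g k"] yc gc by simp
    moreover have "Q *\<^sub>v ?u = 0\<^sub>v q" using Qyh yc Q by (simp add: mult_mat_vec)
    ultimately show ?thesis using kernel_cancel[OF Q, of ?u "g k" "(t k)\<^sup>2"] t2[of k] gc yc by simp
  qed
  show "Q *\<^sub>v (y \<circ>\<^sub>v w + h \<circ>\<^sub>v h) = 0\<^sub>v q"
  proof (rule mult_mat_vec_limit_0[OF Q _ gc g0])
    fix i assume i: "i < n"
    have "(\<lambda>k. y $ i * z k $ i + h $ i * h $ i + t k * f k $ i) \<longlonglongrightarrow> y $ i * w $ i + h $ i * h $ i + 0 * (h \<circ>\<^sub>v w) $ i"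
      by (intro tendsto_intros zlim flim i t)
    then show "(\<lambda>k. g k $ i) \<longlonglongrightarrow> (y \<circ>\<^sub>v w + h \<circ>\<^sub>v h) $ i"
      using i yc hc by (simp add: g_def carrier_vecD[OF z] carrier_vecD[OF fc])
  qed (use yc hc in simp)
  \<comment> \<open>Now \<open>y \<circ> z + h \<circ> h\<close> is in the kernel for every
    \<open>k\<close>, so cancelling \<open>t\<close> passes the equation from \<open>g\<close> to
    the remainder \<open>f\<close>.\<close>
  {
    assume Qy: "\<And>x. x \<in> carrier_vec n \<Longrightarrow> Q *\<^sub>v (y \<circ>\<^sub>v x) = 0\<^sub>v q" and Qhh: "Q *\<^sub>v (h \<circ>\<^sub>v h) = 0\<^sub>v q"
    have "Q *\<^sub>v (y \<circ>\<^sub>v z k + h \<circ>\<^sub>v h) = 0\<^sub>v q" for k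
      using mult_add_distrib_mat_vec[OF Q, of "y \<circ>\<^sub>v z k" "h \<circ>\<^sub>v h"] Qy[OF z] Qhh yc hc by simp
    then have "Q *\<^sub>v f k = 0\<^sub>v q" for k
      using kernel_cancel[OF Q _ fc _ g0[of k, unfolded g_def]] t(1)[of k] yc hc by simp
  } note f0 = this
  show "Q *\<^sub>v (h \<circ>\<^sub>v w) = 0\<^sub>v q"
    if "\<And>x. x \<in> carrier_vec n \<Longrightarrow> Q *\<^sub>v (y \<circ>\<^sub>v x) = 0\<^sub>v q" "Q *\<^sub>v (h \<circ>\<^sub>v h) = 0\<^sub>v q"
    using mult_mat_vec_limit_0[OF Q _ fc f0[OF that] flim] hc by simp
  show "Q *\<^sub>v (w \<circ>\<^sub>v w) = 0\<^sub>v q"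
    if Qy: "\<And>x. x \<in> carrier_vec n \<Longrightarrow> Q *\<^sub>v (y \<circ>\<^sub>v x) = 0\<^sub>v q"
      and Qh: "\<And>x. x \<in> carrier_vec n \<Longrightarrow> Q *\<^sub>v (h \<circ>\<^sub>v x) = 0\<^sub>v q"
  proof (rule mult_mat_vec_limit_0[OF Q])
    \<comment> \<open>The leading term of \<open>f\<close> is killed as well, and cancelling
      \<open>t / 4\<close> leaves \<open>z \<circ> z\<close>.\<close>
    show "Q *\<^sub>v (z k \<circ>\<^sub>v z k) = 0\<^sub>v q" for k
      using kernel_cancel[OF Q _ _ Qh[OF z] f0[OF Qy Qh[OF hc], of k, unfolded f_def]] t(1)[of k] hc z by simp
    fix i assume i: "i < n"
    have "(\<lambda>k. z k $ i * z k $ i) \<longlonglongrightarrow> w $ i * w $ i" by (intro tendsto_intros zlim i)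
    then show "(\<lambda>k. (z k \<circ>\<^sub>v z k) $ i) \<longlonglongrightarrow> (w \<circ>\<^sub>v w) $ i"
      using i wc by (simp add: carrier_vecD[OF z])
  qed (use wc z in auto)
qed

section \<open>Feasible second-order curves\<close>

text \<open>Take the root with the sign of \<open>a\<close>: then \<open>x + a\<close> is at least
  as large as \<open>a\<close> in absolute value, while \<open>x - a\<close> times
  \<open>x + a\<close> is \<open>-d\<close>.\<close>

lemma square_root_near:
  fixes a d :: real
  assumes "a \<noteq> 0" "\<bar>d\<bar> \<le> a\<^sup>2"
  shows "\<exists>x. x\<^sup>2 = a\<^sup>2 - d \<and> \<bar>x - a\<bar> \<le> \<bar>d\<bar> / \<bar>a\<bar>"
proof -
  define r where "r = sqrt (a\<^sup>2 - d)"
  define x where "x = sgn a * r"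
  have r: "r \<ge> 0" "r\<^sup>2 = a\<^sup>2 - d" using assms by (auto simp: r_def)
  have x2: "x\<^sup>2 = a\<^sup>2 - d" using r assms by (simp add: x_def power_mult_distrib sgn_if)
  have "\<bar>x + a\<bar> \<ge> \<bar>a\<bar>" using r(1) assms(1) by (auto simp: x_def sgn_if)
  then have "\<bar>x - a\<bar> * \<bar>a\<bar> \<le> \<bar>x - a\<bar> * \<bar>x + a\<bar>" by (simp add: mult_left_mono)
  also have "\<dots> = \<bar>x\<^sup>2 - a\<^sup>2\<bar>" by (simp add: abs_mult[symmetric] power2_eq_square algebra_simps)
  also have "\<dots> = \<bar>d\<bar>" using x2 by simp
  finally show ?thesis using x2 assms(1) by (auto simp: field_simps)
qed

text \<open>The correction carries the factor \<open>y\<close> at order three and \<open>y\<close>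
  or \<open>h\<close> at order four, so it is always small against the first nonvanishing
  coefficient of the curve.\<close>

lemma coordinate_correction:
  fixes y h w \<alpha> \<beta> \<gamma> :: real
  shows "\<exists>C. \<forall>\<^sub>F t in at_right 0. \<exists>x.
    x\<^sup>2 = (y + t * h + t\<^sup>2 / 2 * w)\<^sup>2 - (t ^ 3 * (y * \<alpha>) + t ^ 4 / 4 * (h * \<beta> + y * \<gamma>)) \<and>
    \<bar>x - (y + t * h + t\<^sup>2 / 2 * w)\<bar> \<le> C * t ^ 3"
proof -
  consider "y \<noteq> 0" | "y = 0" "h \<noteq> 0" | "y = 0" "h = 0" by blast
  then show ?thesis
  proof cases
    case 1
    \<comment> \<open>For \<open>0 < t < 1\<close> one has \<open>t ^ 4 / 4 \<le> t ^ 3\<close>, so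
      \<open>K * t ^ 3\<close> bounds the whole correction.\<close>
    define K where "K = \<bar>y * \<alpha>\<bar> + \<bar>h * \<beta> + y * \<gamma>\<bar>"
    have K: "K \<ge> 0" by (simp add: K_def)
    have "((\<lambda>t. \<bar>y + t * h + t\<^sup>2 / 2 * w\<bar>) \<longlongrightarrow> \<bar>y + 0 * h + 0\<^sup>2 / 2 * w\<bar>) (at_right 0)"
      by (intro tendsto_intros) auto
    then have e1: "\<forall>\<^sub>F t in at_right 0. \<bar>y\<bar> / 2 < \<bar>y + t * h + t\<^sup>2 / 2 * w\<bar>"
      using 1 by (intro order_tendstoD) auto
    have "((\<lambda>t. K * t ^ 3) \<longlongrightarrow> K * 0 ^ 3) (at_right 0)" by (intro tendsto_intros)
    then have e2: "\<forall>\<^sub>F t in at_right 0. K * t ^ 3 < (\<bar>y\<bar> / 2)\<^sup>2"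
      using 1 by (intro order_tendstoD) auto
    have e3: "\<forall>\<^sub>F t :: real in at_right 0. 0 < t \<and> t < 1"
      using eventually_at_right_real[of 0 1] by (auto simp: eventually_conj_iff elim: eventually_mono)
    show ?thesis
    \<comment> \<open>The constant comes from dividing \<open>K * t ^ 3\<close> by the lower bound
      in \<open>e1\<close>; \<open>e2\<close> keeps the radicand nonnegative.\<close>
    proof (intro exI[of _ "2 * K / \<bar>y\<bar>"], use e1 e2 e3 in eventually_elim)
      case (elim t)
      let ?a = "y + t * h + t\<^sup>2 / 2 * w" and ?d = "t ^ 3 * (y * \<alpha>) + t ^ 4 / 4 * (h * \<beta> + y * \<gamma>)"
      have "t ^ 4 / 4 \<le> t ^ 3" using elim power_decreasing[of 3 4 t] zero_less_power[of t 3] by linarith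
      then have "t ^ 4 / 4 * \<bar>h * \<beta> + y * \<gamma>\<bar> \<le> t ^ 3 * \<bar>h * \<beta> + y * \<gamma>\<bar>"
        by (rule mult_right_mono) simp
      moreover have "\<bar>?d\<bar> \<le> \<bar>t ^ 3 * (y * \<alpha>)\<bar> + \<bar>t ^ 4 / 4 * (h * \<beta> + y * \<gamma>)\<bar>"
        by (rule abs_triangle_ineq)
      moreover have "\<bar>t ^ 3 * (y * \<alpha>)\<bar> = t ^ 3 * \<bar>y * \<alpha>\<bar>"
        "\<bar>t ^ 4 / 4 * (h * \<beta> + y * \<gamma>)\<bar> = t ^ 4 / 4 * \<bar>h * \<beta> + y * \<gamma>\<bar>"
        using elim by (simp_all add: abs_mult)
      moreover have "K * t ^ 3 = t ^ 3 * \<bar>y * \<alpha>\<bar> + t ^ 3 * \<bar>h * \<beta> + y * \<gamma>\<bar>"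
        by (simp add: K_def algebra_simps)
      ultimately have d: "\<bar>?d\<bar> \<le> K * t ^ 3" by linarith
      have "(\<bar>y\<bar> / 2)\<^sup>2 \<le> ?a\<^sup>2" using elim power_mono[of "\<bar>y\<bar> / 2" "\<bar>?a\<bar>" 2] by simp
      then have "\<bar>?d\<bar> \<le> ?a\<^sup>2" using d elim by linarith
      moreover have "?a \<noteq> 0" using elim 1 by auto
      ultimately obtain x where x: "x\<^sup>2 = ?a\<^sup>2 - ?d" "\<bar>x - ?a\<bar> \<le> \<bar>?d\<bar> / \<bar>?a\<bar>"
        using square_root_near by blast
      have "\<bar>?d\<bar> / \<bar>?a\<bar> \<le> (K * t ^ 3) / (\<bar>y\<bar> / 2)"
        using d elim 1 K by (intro frac_le) auto
      also have "\<dots> = 2 * K / \<bar>y\<bar> * t ^ 3" by simp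
      finally show ?case using x by (intro exI[of _ x]) auto
    qed
  next
    case 2
    have "((\<lambda>t. \<bar>h + t / 2 * w\<bar>) \<longlongrightarrow> \<bar>h + 0 / 2 * w\<bar>) (at_right 0)"
      by (intro tendsto_intros) auto
    then have e1: "\<forall>\<^sub>F t in at_right 0. \<bar>h\<bar> / 2 < \<bar>h + t / 2 * w\<bar>"
      using 2 by (intro order_tendstoD) auto
    have "((\<lambda>t. t\<^sup>2 * \<bar>\<beta>\<bar>) \<longlongrightarrow> 0\<^sup>2 * \<bar>\<beta>\<bar>) (at_right 0)" by (intro tendsto_intros)
    \<comment> \<open>The correction factors in absolute value as \<open>t \<bar>h\<bar> / 2\<close>
      times \<open>t ^ 3 \<bar>\<beta>\<bar> / 2\<close>. This bound makes the second factor at most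
      the first, so the radicand is nonnegative.\<close>
    then have e2: "\<forall>\<^sub>F t in at_right 0. t\<^sup>2 * \<bar>\<beta>\<bar> < \<bar>h\<bar>"
      using 2 by (intro order_tendstoD) auto
    have e3: "\<forall>\<^sub>F t :: real in at_right 0. 0 < t"
      by (simp add: eventually_at_right_less)
    show ?thesis
    proof (intro exI[of _ "\<bar>\<beta>\<bar> / 2"], use e1 e2 e3 in eventually_elim)
      case (elim t)
      let ?a = "t * (h + t / 2 * w)" and ?d = "t ^ 4 / 4 * (h * \<beta>)"
      have a: "y + t * h + t\<^sup>2 / 2 * w = ?a" using 2 by (simp add: power2_eq_square algebra_simps)
      have a_ge: "t * (\<bar>h\<bar> / 2) \<le> \<bar>?a\<bar>" using elim by (simp add: abs_mult)
      have d: "\<bar>?d\<bar> = (t * (\<bar>h\<bar> / 2)) * (t ^ 3 * \<bar>\<beta>\<bar> / 2)"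
        using elim by (simp add: abs_mult power_numeral_reduce)
      have "t ^ 3 * \<bar>\<beta>\<bar> / 2 \<le> t * (\<bar>h\<bar> / 2)"
        using elim by (simp add: power_numeral_reduce)
      then have "\<bar>?d\<bar> \<le> (t * (\<bar>h\<bar> / 2))\<^sup>2" unfolding d power2_eq_square using elim by (intro mult_left_mono) auto
      also have "\<dots> \<le> ?a\<^sup>2" using power_mono[OF a_ge, of 2] elim by simp
      finally have "\<bar>?d\<bar> \<le> ?a\<^sup>2" .
      moreover have "?a \<noteq> 0" using elim 2 by auto
      ultimately obtain x where x: "x\<^sup>2 = ?a\<^sup>2 - ?d" "\<bar>x - ?a\<bar> \<le> \<bar>?d\<bar> / \<bar>?a\<bar>"
        using square_root_near by blast
      have "\<bar>?d\<bar> / \<bar>?a\<bar> \<le> \<bar>?d\<bar> / (t * (\<bar>h\<bar> / 2))"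
        using a_ge elim 2 by (intro divide_left_mono mult_pos_pos) auto
      also have "\<dots> = \<bar>\<beta>\<bar> / 2 * t ^ 3" unfolding d using elim 2 by simp
      finally show ?case using x 2 unfolding a by (intro exI[of _ x]) auto
    qed
  next
    case 3
    \<comment> \<open>The correction is zero, so the value of the curve itself serves as
      \<open>x\<close>, with constant 0.\<close>
    then show ?thesis
      by (intro exI[of _ 0] always_eventually allI exI[of _ "_ :: real"]) auto
  qed
qed

text \<open>Sample the one-sided limit along \<open>1 / (k + 1)\<close>.\<close>

lemma inner_tangent2_subset_outer: "inner_tangent2 S x h \<subseteq> outer_tangent2 S x h"
proof
  fix w assume w: "w \<in> inner_tangent2 S x h"
  define t where "t k = inverse (real (Suc k))" for k
  have t0: "t \<longlonglongrightarrow> 0" unfolding t_def by (rule LIMSEQ_inverse_real_of_nat)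
  have tpos: "\<forall>k. t k > 0" by (simp add: t_def)
  have "filterlim t (at_right 0) sequentially"
    using t0 tpos by (intro tendsto_imp_filterlim_at_right) auto
  then have "(\<lambda>k. set_dist (x + t k \<cdot>\<^sub>v h + ((t k)\<^sup>2 / 2) \<cdot>\<^sub>v w) S) \<in> o(\<lambda>k. (t k)\<^sup>2)"
    using w landau_o.small.compose[of "\<lambda>t. set_dist (x + t \<cdot>\<^sub>v h + (t\<^sup>2 / 2) \<cdot>\<^sub>v w) S" "at_right 0" "\<lambda>t. t\<^sup>2" t sequentially]
    by (simp add: inner_tangent2_def)
  then show "w \<in> outer_tangent2 S x h"
    using w t0 tpos unfolding inner_tangent2_def outer_tangent2_def by blast
qed

text \<open>After the coordinatewise correction, every term of the square beyond
  \<open>y \<circ> y\<close> lies in the kernel of \<open>A\<close>. The corrected point is feasible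
  at distance \<open>O(t ^ 3)\<close>, which is \<open>o(t\<^sup>2)\<close>.\<close>

lemma set_dist_second_order_curve:
  assumes A: "A \<in> carrier_mat m n" and y: "y \<in> Pset A b"
    and car: "h \<in> carrier_vec n" "w \<in> carrier_vec n" "\<alpha> \<in> carrier_vec n" "\<beta> \<in> carrier_vec n" "\<gamma> \<in> carrier_vec n"
    and yh: "A *\<^sub>v (y \<circ>\<^sub>v h) = 0\<^sub>v m" and yw: "A *\<^sub>v (y \<circ>\<^sub>v w + h \<circ>\<^sub>v h) = 0\<^sub>v m"
    and hw: "A *\<^sub>v (h \<circ>\<^sub>v w) = A *\<^sub>v (y \<circ>\<^sub>v \<alpha>)"
    and ww: "A *\<^sub>v (w \<circ>\<^sub>v w) = A *\<^sub>v (h \<circ>\<^sub>v \<beta> + y \<circ>\<^sub>v \<gamma>)"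
  shows "(\<lambda>t. set_dist (y + t \<cdot>\<^sub>v h + (t\<^sup>2 / 2) \<cdot>\<^sub>v w) (Pset A b)) \<in> o[at_right 0](\<lambda>t. t\<^sup>2)"
proof -
  have yc: "y \<in> carrier_vec n" and Ayy: "A *\<^sub>v (y \<circ>\<^sub>v y) = b" using y A by (auto simp: Pset_def)
  let ?a = "\<lambda>t i. y $ i + t * h $ i + t\<^sup>2 / 2 * w $ i"
  let ?d = "\<lambda>t i. t ^ 3 * (y $ i * \<alpha> $ i) + t ^ 4 / 4 * (h $ i * \<beta> $ i + y $ i * \<gamma> $ i)"
  let ?near = "\<lambda>t i C x. x\<^sup>2 = (?a t i)\<^sup>2 - ?d t i \<and> \<bar>x - ?a t i\<bar> \<le> C * t ^ 3"
  have "\<forall>i. \<exists>C. \<forall>\<^sub>F t in at_right 0. \<exists>x. ?near t i C x"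
    by (intro allI coordinate_correction)
  then obtain C where C: "\<forall>i. \<forall>\<^sub>F t in at_right 0. \<exists>x. ?near t i (C i) x"
    by (rule choice[THEN exE])
  \<comment> \<open>The sum of absolute values dominates each \<open>C i\<close>, whose sign is
    unknown; the factor \<open>n\<close> comes from bounding the norm by coordinates.\<close>
  define K where "K = real n * (\<Sum>i<n. \<bar>C i\<bar>)"
  have "\<forall>\<^sub>F t in at_right 0. \<forall>i\<in>{..<n}. \<exists>x. ?near t i (C i) x"
    by (rule eventually_ball_finite[OF finite_lessThan]) (intro ballI C[rule_format])
  moreover have "\<forall>\<^sub>F t :: real in at_right 0. 0 < t" by (simp add: eventually_at_right_less)
  ultimately have bound: "\<forall>\<^sub>F t in at_right 0. norm (set_dist (y + t \<cdot>\<^sub>v h + (t\<^sup>2 / 2) \<cdot>\<^sub>v w) (Pset A b) / t\<^sup>2) \<le> norm t * K"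
  proof eventually_elim
    case (elim t)
    let ?p = "y + t \<cdot>\<^sub>v h + (t\<^sup>2 / 2) \<cdot>\<^sub>v w"
    obtain x where near: "\<forall>i\<in>{..<n}. ?near t i (C i) (x i)"
      using bchoice[OF elim(1)] by (rule exE)
    then have x: "\<And>i. i < n \<Longrightarrow> (x i)\<^sup>2 = (?a t i)\<^sup>2 - ?d t i" "\<And>i. i < n \<Longrightarrow> \<bar>x i - ?a t i\<bar> \<le> C i * t ^ 3"
      by (simp_all only: lessThan_iff Ball_def)
    define s where "s = vec n x"
    let ?f = "h \<circ>\<^sub>v \<beta> + y \<circ>\<^sub>v \<gamma>"
    \<comment> \<open>Grouped by powers of \<open>t\<close> so that \<open>A\<close> kills every
      group except \<open>y \<circ> y\<close>.\<close>
    have s_sq: "s \<circ>\<^sub>v s = y \<circ>\<^sub>v y + (2 * t) \<cdot>\<^sub>v (y \<circ>\<^sub>v h) + t\<^sup>2 \<cdot>\<^sub>v (y \<circ>\<^sub>v w + h \<circ>\<^sub>v h)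
        + t ^ 3 \<cdot>\<^sub>v (h \<circ>\<^sub>v w - y \<circ>\<^sub>v \<alpha>) + (t ^ 4 / 4) \<cdot>\<^sub>v (w \<circ>\<^sub>v w - ?f)"
    proof (rule eq_vecI)
      fix i
      assume "i < dim_vec (y \<circ>\<^sub>v y + (2 * t) \<cdot>\<^sub>v (y \<circ>\<^sub>v h) + t\<^sup>2 \<cdot>\<^sub>v (y \<circ>\<^sub>v w + h \<circ>\<^sub>v h)
        + t ^ 3 \<cdot>\<^sub>v (h \<circ>\<^sub>v w - y \<circ>\<^sub>v \<alpha>) + (t ^ 4 / 4) \<cdot>\<^sub>v (w \<circ>\<^sub>v w - ?f))"
      then have i: "i < n" using yc car by simp
      have "(s \<circ>\<^sub>v s) $ i = (?a t i)\<^sup>2 - ?d t i" using x(1)[OF i] i by (simp add: s_def power2_eq_square)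
      also have "\<dots> = y $ i * y $ i + 2 * t * (y $ i * h $ i) + t\<^sup>2 * (y $ i * w $ i + h $ i * h $ i)
        + t ^ 3 * (h $ i * w $ i - y $ i * \<alpha> $ i) + t ^ 4 / 4 * (w $ i * w $ i - (h $ i * \<beta> $ i + y $ i * \<gamma> $ i))"
        by (simp add: power_numeral_reduce field_simps)
      finally show "(s \<circ>\<^sub>v s) $ i = (y \<circ>\<^sub>v y + (2 * t) \<cdot>\<^sub>v (y \<circ>\<^sub>v h) + t\<^sup>2 \<cdot>\<^sub>v (y \<circ>\<^sub>v w + h \<circ>\<^sub>v h)
        + t ^ 3 \<cdot>\<^sub>v (h \<circ>\<^sub>v w - y \<circ>\<^sub>v \<alpha>) + (t ^ 4 / 4) \<cdot>\<^sub>v (w \<circ>\<^sub>v w - ?f)) $ i"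
        using i yc car by simp
    qed (use yc car in \<open>simp add: s_def\<close>)
    have z: "A *\<^sub>v (h \<circ>\<^sub>v w - y \<circ>\<^sub>v \<alpha>) = 0\<^sub>v m" "A *\<^sub>v (w \<circ>\<^sub>v w - ?f) = 0\<^sub>v m"
      using mult_minus_distrib_mat_vec[OF A, of "h \<circ>\<^sub>v w" "y \<circ>\<^sub>v \<alpha>"]
        mult_minus_distrib_mat_vec[OF A, of "w \<circ>\<^sub>v w" ?f] hw ww car yc A by simp_all
    \<comment> \<open>As a rewrite rule this removes the last summand of \<open>s_sq\<close>; four
      applications leave \<open>y \<circ> y\<close>.\<close>
    have "A *\<^sub>v (u + c \<cdot>\<^sub>v v) = A *\<^sub>v u"
      if "u \<in> carrier_vec n" "v \<in> carrier_vec n" "A *\<^sub>v v = 0\<^sub>v m" for c u v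
      using mult_add_distrib_mat_vec[OF A, of u "c \<cdot>\<^sub>v v"] mult_mat_vec[OF A, of v c] that A by simp
    then have "A *\<^sub>v (s \<circ>\<^sub>v s) = A *\<^sub>v (y \<circ>\<^sub>v y)"
      unfolding s_sq using yc car yh yw z by simp
    then have s: "s \<in> Pset A b" using Ayy A by (simp add: Pset_def s_def)
    have "vec_norm2 (?p - s) \<le> real n * ((\<Sum>i<n. \<bar>C i\<bar>) * t ^ 3)"
    proof (rule vec_norm2_le_dim_mult)
      fix i assume i: "i < n"
      have "\<bar>(?p - s) $ i\<bar> = \<bar>x i - ?a t i\<bar>" using i yc car by (simp add: s_def abs_minus_commute)
      also have "\<dots> \<le> \<bar>C i\<bar> * t ^ 3"
        using x(2)[OF i] elim(2) by (intro order_trans[OF x(2)[OF i]] mult_right_mono) auto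
      also have "\<dots> \<le> (\<Sum>i<n. \<bar>C i\<bar>) * t ^ 3"
        using i elim(2) by (intro mult_right_mono member_le_sum) auto
      finally show "\<bar>(?p - s) $ i\<bar> \<le> (\<Sum>i<n. \<bar>C i\<bar>) * t ^ 3" .
    qed (simp add: s_def yc car)
    then have "set_dist ?p (Pset A b) \<le> K * t ^ 3"
      using set_dist_le[OF s, of ?p] by (simp add: K_def mult.assoc)
    moreover have "0 \<le> set_dist ?p (Pset A b)" using y by (intro set_dist_nonneg) auto
    ultimately show ?case
      using elim(2) by (simp add: field_simps power2_eq_square power3_eq_cube)
  qed
  show ?thesis
  proof (rule smalloI_tendsto)
    show "((\<lambda>t. set_dist (y + t \<cdot>\<^sub>v h + (t\<^sup>2 / 2) \<cdot>\<^sub>v w) (Pset A b) / t\<^sup>2) \<longlongrightarrow> 0) (at_right 0)"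
      by (rule tendsto_0_le[OF _ bound]) (rule tendsto_ident_at)
    show "\<forall>\<^sub>F t :: real in at_right 0. t\<^sup>2 \<noteq> 0"
      by (rule eventually_mono[OF eventually_at_right_less]) simp
  qed
qed

section \<open>Both inclusions for the second-order tangent sets\<close>

theorem proposition3:
  fixes A M N V W :: "real mat" and b y h :: "real vec" and m n r s p :: nat
  assumes "A \<in> carrier_mat m n" and "vec_space.rank m A = m"
    and "b \<in> carrier_vec m"
    and "{x \<in> carrier_vec n. 0\<^sub>v n \<le> x \<and> A *\<^sub>v x = b} \<noteq> {}"
    and "y \<in> Pset A b" and "regular_rep A y M N r"
    and "h \<in> tangent_cone (Pset A b) y"
    and "V \<in> carrier_mat s (m - r)" and "W \<in> carrier_mat p (m - r)" and "s + p = m - r"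
    and "vec_space.rank (m - r) (V @\<^sub>r W) = m - r"
    and "rows_basis V (vec_space.col_space (m - r) (N * A * Diag h))"
    and "V * W\<^sup>T = 0\<^sub>m s p"
  shows "inner_tangent2 (Pset A b) y h = outer_tangent2 (Pset A b) y h \<and>
    outer_tangent2 (Pset A b) y h =
      {w \<in> carrier_vec n.
        M * A *\<^sub>v (y \<circ>\<^sub>v w + h \<circ>\<^sub>v h) = 0\<^sub>v r \<and>
        V * N * A *\<^sub>v (h \<circ>\<^sub>v w) = 0\<^sub>v s \<and>
        W * N * A *\<^sub>v (w \<circ>\<^sub>v w) = 0\<^sub>v p}"
proof -
  note A = assms(1) and y = assms(5) and V = assms(8) and W = assms(9)
  let ?q = "m - r" and ?B = "A * Diag y" and ?D = "N * A * Diag h"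
  have yc: "y \<in> carrier_vec n" using y A by (simp add: Pset_def)
  have M: "M \<in> carrier_mat r m" and N: "N \<in> carrier_mat ?q m"
    and Mb: "rows_basis M (vec_space.col_space m ?B)"
    and Nb: "rows_basis N (vec_module.orthogonal_complement m (vec_space.col_space m ?B))"
    using assms(6) A by (auto simp: regular_rep_def)
  note h = tangent_cone_equations(1)[OF A subset_refl y assms(7)]
  note Ayh = tangent_cone_equations(2)[OF A subset_refl y assms(7)]
  have B: "?B \<in> carrier_mat m n" using mult_carrier_mat[OF A Diag_carrier[OF yc]] .
  have NA: "N * A \<in> carrier_mat ?q n" using N A by simp
  have D: "?D \<in> carrier_mat ?q n" using mult_carrier_mat[OF NA Diag_carrier[OF h]] .
  have Bx: "vec_space.col_space m ?B = (\<lambda>x. A *\<^sub>v (y \<circ>\<^sub>v x)) ` carrier_vec n"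
    using col_space_mult_Diag[OF A yc] .
  have Dx: "vec_space.col_space ?q ?D = (\<lambda>x. N * A *\<^sub>v (h \<circ>\<^sub>v x)) ` carrier_vec n"
    using col_space_mult_Diag[OF NA h] .
  have rangeM: "vec_space.col_space m ?B = (\<lambda>a. M\<^sup>T *\<^sub>v a) ` carrier_vec r"
    using rows_basis_range[OF M Mb submodule_col_space[OF B]] .
  have rangeV: "vec_space.col_space ?q ?D = (\<lambda>a. V\<^sup>T *\<^sub>v a) ` carrier_vec s"
    using rows_basis_range[OF V assms(12) submodule_col_space[OF D]] .
  have NA_vec: "N * A *\<^sub>v x = N *\<^sub>v (A *\<^sub>v x)" if "x \<in> carrier_vec n" for x
    using assoc_mult_mat_vec[OF N A that] .
  have MA_vec: "M * A *\<^sub>v x = M *\<^sub>v (A *\<^sub>v x)" if "x \<in> carrier_vec n" for x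
    using assoc_mult_mat_vec[OF M A that] .
  have VNA: "V * N * A = V * (N * A)" and WNA: "W * N * A = W * (N * A)"
    using assoc_mult_mat[OF V N A] assoc_mult_mat[OF W N A] .
  have VNA_vec: "V * N * A *\<^sub>v x = V *\<^sub>v (N * A *\<^sub>v x)" if "x \<in> carrier_vec n" for x
    unfolding VNA using assoc_mult_mat_vec[OF V NA that] .
  have WNA_vec: "W * N * A *\<^sub>v x = W *\<^sub>v (N * A *\<^sub>v x)" if "x \<in> carrier_vec n" for x
    unfolding WNA using assoc_mult_mat_vec[OF W NA that] .
  have NAy: "N * A *\<^sub>v (y \<circ>\<^sub>v x) = 0\<^sub>v ?q" if "x \<in> carrier_vec n" for x
    using complement_basis_mult_0[OF B N Nb, of "A *\<^sub>v (y \<circ>\<^sub>v x)"] that NA_vec[of "y \<circ>\<^sub>v x"] yc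
    unfolding Bx by simp
  \<comment> \<open>The range of \<open>N * A * Diag h\<close> is the row space of \<open>V\<close>,
    which \<open>W\<close> kills.\<close>
  have WNAh: "W * N * A *\<^sub>v (h \<circ>\<^sub>v x) = 0\<^sub>v p" if "x \<in> carrier_vec n" for x
  proof -
    have "N * A *\<^sub>v (h \<circ>\<^sub>v x) \<in> (\<lambda>a. V\<^sup>T *\<^sub>v a) ` carrier_vec s"
      unfolding rangeV[symmetric] Dx using that by simp
    then show ?thesis
      using WNA_vec[of "h \<circ>\<^sub>v x"] orthogonal_block_mult_0[OF V W assms(13)] h by auto
  qed
  \<comment> \<open>Feasible points also solve every system multiplied from the left. So the
    necessary conditions may be used for \<open>N * A\<close> and \<open>W * N * A\<close> while the
    tangent sets remain those of \<open>Pset A b\<close>.\<close>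
  have sub: "Pset A b \<subseteq> Pset (L * A) (L *\<^sub>v b)" if "L \<in> carrier_mat k m" for L k
    using that A assoc_mult_mat_vec[OF that A] by (auto simp: Pset_def)
  \<comment> \<open>Since \<open>N * A\<close> removes the first-order term, tangency of
    \<open>h\<close> yields a condition at second order.\<close>
  have NAhh: "N * A *\<^sub>v (h \<circ>\<^sub>v h) = 0\<^sub>v ?q"
    using tangent_cone_equations(3)[OF NA sub[OF N] y assms(7) NAy] .
  \<comment> \<open>What \<open>N\<close> kills lies in the range of \<open>A * Diag y\<close>; this
    supplies the vectors \<open>\<alpha>\<close> and \<open>\<gamma>\<close>.\<close>
  have preimage: "\<exists>x\<in>carrier_vec n. A *\<^sub>v u = A *\<^sub>v (y \<circ>\<^sub>v x)"
    if u: "u \<in> carrier_vec n" and Nu: "N * A *\<^sub>v u = 0\<^sub>v ?q" for u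
  proof -
    have "A *\<^sub>v u \<in> carrier_vec m" using A u by simp
    then obtain x where "x \<in> carrier_vec n" "A *\<^sub>v u = ?B *\<^sub>v x"
      using kernel_of_complement_basis[OF B N Nb, of "A *\<^sub>v u"] Nu NA_vec[OF u] by metis
    then show ?thesis using mult_Diag_vec[OF A _ yc] by auto
  qed
  let ?T = "{w \<in> carrier_vec n. M * A *\<^sub>v (y \<circ>\<^sub>v w + h \<circ>\<^sub>v h) = 0\<^sub>v r \<and>
    V * N * A *\<^sub>v (h \<circ>\<^sub>v w) = 0\<^sub>v s \<and> W * N * A *\<^sub>v (w \<circ>\<^sub>v w) = 0\<^sub>v p}"
  have "outer_tangent2 (Pset A b) y h \<subseteq> ?T"
  proof
    fix w assume w: "w \<in> outer_tangent2 (Pset A b) y h"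
    have wc: "w \<in> carrier_vec n" using outer_tangent2_equations(1)[OF A subset_refl y h Ayh w] .
    have WN: "W * N \<in> carrier_mat p m" using W N by simp
    have WNAc: "W * N * A \<in> carrier_mat p n" using WN A by simp
    have WNAy: "W * N * A *\<^sub>v (y \<circ>\<^sub>v x) = 0\<^sub>v p" if "x \<in> carrier_vec n" for x
      using WNA_vec[of "y \<circ>\<^sub>v x"] NAy[OF that] yc mult_mat_0_vec[OF W] by simp
    \<comment> \<open>The stronger equations before multiplication by \<open>M\<close> and
      \<open>V\<close> are obtained first; multiplying gives the stated ones.\<close>
    have "A *\<^sub>v (y \<circ>\<^sub>v w + h \<circ>\<^sub>v h) = 0\<^sub>v m"
      using outer_tangent2_equations(2)[OF A subset_refl y h Ayh w] .
    then have "M * A *\<^sub>v (y \<circ>\<^sub>v w + h \<circ>\<^sub>v h) = 0\<^sub>v r"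
      using MA_vec[of "y \<circ>\<^sub>v w + h \<circ>\<^sub>v h"] yc h mult_mat_0_vec[OF M] by simp
    moreover have "N * A *\<^sub>v (h \<circ>\<^sub>v w) = 0\<^sub>v ?q"
      using outer_tangent2_equations(3)[OF NA sub[OF N] y h NAy[OF h] w NAy NAhh] .
    then have "V * N * A *\<^sub>v (h \<circ>\<^sub>v w) = 0\<^sub>v s"
      using VNA_vec[of "h \<circ>\<^sub>v w"] h mult_mat_0_vec[OF V] by simp
    moreover have "W * N * A *\<^sub>v (w \<circ>\<^sub>v w) = 0\<^sub>v p"
      using outer_tangent2_equations(4)[OF WNAc sub[OF WN] y h WNAy[OF h] w WNAy WNAh] .
    ultimately show "w \<in> ?T" using wc by simp
  qed
  moreover have "?T \<subseteq> inner_tangent2 (Pset A b) y h"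
  proof
    fix w assume "w \<in> ?T"
    then have w: "w \<in> carrier_vec n" and eM: "M * A *\<^sub>v (y \<circ>\<^sub>v w + h \<circ>\<^sub>v h) = 0\<^sub>v r"
      and eV: "V * N * A *\<^sub>v (h \<circ>\<^sub>v w) = 0\<^sub>v s" and eW: "W * N * A *\<^sub>v (w \<circ>\<^sub>v w) = 0\<^sub>v p" by auto
    let ?u = "y \<circ>\<^sub>v w + h \<circ>\<^sub>v h"
    have u: "?u \<in> carrier_vec n" using yc h by simp
    \<comment> \<open>This puts \<open>A *\<^sub>v ?u\<close> into the range of
      \<open>A * Diag y\<close>, the row space of \<open>M\<close>. There \<open>M\<close> is
      injective, so the equation under \<open>M\<close> forces it to vanish.\<close>
    have "N * A *\<^sub>v ?u = 0\<^sub>v ?q"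
      using mult_add_distrib_mat_vec[OF NA, of "y \<circ>\<^sub>v w" "h \<circ>\<^sub>v h"] NAy[OF w] NAhh yc h by simp
    then obtain x where "x \<in> carrier_vec n" "A *\<^sub>v ?u = A *\<^sub>v (y \<circ>\<^sub>v x)" using preimage[OF u] by auto
    then have "A *\<^sub>v ?u \<in> vec_space.col_space m ?B" unfolding Bx by auto
    then obtain a where a: "a \<in> carrier_vec r" "A *\<^sub>v ?u = M\<^sup>T *\<^sub>v a" unfolding rangeM by auto
    have Au: "A *\<^sub>v ?u = 0\<^sub>v m"
      using transpose_kernel_trivial[OF M a(1)] eM MA_vec[OF u] a(2) by simp
    have hw: "h \<circ>\<^sub>v w \<in> carrier_vec n" using h by simp
    \<comment> \<open>The same argument for \<open>V\<close>, injective on its row space, the range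
      of \<open>N * A * Diag h\<close>.\<close>
    have "N * A *\<^sub>v (h \<circ>\<^sub>v w) \<in> vec_space.col_space ?q ?D" unfolding Dx using w by auto
    then obtain a' where a': "a' \<in> carrier_vec s" "N * A *\<^sub>v (h \<circ>\<^sub>v w) = V\<^sup>T *\<^sub>v a'" unfolding rangeV by auto
    have "N * A *\<^sub>v (h \<circ>\<^sub>v w) = 0\<^sub>v ?q"
      using transpose_kernel_trivial[OF V a'(1)] eV VNA_vec[OF hw] a'(2) by simp
    then obtain \<alpha> where \<alpha>: "\<alpha> \<in> carrier_vec n" "A *\<^sub>v (h \<circ>\<^sub>v w) = A *\<^sub>v (y \<circ>\<^sub>v \<alpha>)"
      using preimage[OF hw] by auto
    have ww: "w \<circ>\<^sub>v w \<in> carrier_vec n" using w by simp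
    \<comment> \<open>Being killed by \<open>W\<close>, this vector lies in the row space of
      \<open>V\<close>, hence in the range of \<open>N * A * Diag h\<close>, which yields
      \<open>\<beta>\<close>.\<close>
    have "N * A *\<^sub>v (w \<circ>\<^sub>v w) \<in> carrier_vec ?q" using mult_mat_vec_carrier[OF NA ww] .
    then obtain c where "c \<in> carrier_vec s" "N * A *\<^sub>v (w \<circ>\<^sub>v w) = V\<^sup>T *\<^sub>v c"
      using kernel_of_orthogonal_block[OF V W assms(10,11,13), of "N * A *\<^sub>v (w \<circ>\<^sub>v w)"] eW WNA_vec[OF ww] by metis
    then have "N * A *\<^sub>v (w \<circ>\<^sub>v w) \<in> vec_space.col_space ?q ?D" unfolding rangeV by auto
    then obtain \<beta> where \<beta>: "\<beta> \<in> carrier_vec n" "N * A *\<^sub>v (w \<circ>\<^sub>v w) = N * A *\<^sub>v (h \<circ>\<^sub>v \<beta>)"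
      unfolding Dx by auto
    have hb: "h \<circ>\<^sub>v \<beta> \<in> carrier_vec n" using h by simp
    \<comment> \<open>Once \<open>h \<circ> \<beta>\<close> is subtracted, \<open>N * A\<close>
      kills the rest, and \<open>preimage\<close> yields \<open>\<gamma>\<close>.\<close>
    have "N * A *\<^sub>v (w \<circ>\<^sub>v w - h \<circ>\<^sub>v \<beta>) = 0\<^sub>v ?q"
      using mult_minus_distrib_mat_vec[OF NA ww hb] \<beta>(2) mult_mat_vec_carrier[OF NA hb] by simp
    then obtain \<gamma> where \<gamma>: "\<gamma> \<in> carrier_vec n" "A *\<^sub>v (w \<circ>\<^sub>v w - h \<circ>\<^sub>v \<beta>) = A *\<^sub>v (y \<circ>\<^sub>v \<gamma>)"
      using preimage[OF minus_carrier_vec[OF ww hb]] by auto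
    have "h \<circ>\<^sub>v \<beta> + (w \<circ>\<^sub>v w - h \<circ>\<^sub>v \<beta>) = w \<circ>\<^sub>v w"
      by (rule eq_vecI) (simp_all add: carrier_vecD[OF h] carrier_vecD[OF w])
    then have "A *\<^sub>v (w \<circ>\<^sub>v w) = A *\<^sub>v (h \<circ>\<^sub>v \<beta> + y \<circ>\<^sub>v \<gamma>)"
      using mult_add_distrib_mat_vec[OF A hb minus_carrier_vec[OF ww hb]]
        mult_add_distrib_mat_vec[OF A hb, of "y \<circ>\<^sub>v \<gamma>"] \<gamma>(2) yc by simp
    then show "w \<in> inner_tangent2 (Pset A b) y h"
      using set_dist_second_order_curve[OF A y h w \<alpha>(1) \<beta>(1) \<gamma>(1) Ayh Au \<alpha>(2)] w yc
      by (simp add: inner_tangent2_def)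
  qed
  \<comment> \<open>The trivial inclusion of the inner set in the outer one closes the cycle of
    inclusions.\<close>
  ultimately show ?thesis using inner_tangent2_subset_outer by blast
qed

end
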